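(* Let $l>0$ and $m>0$, and consider the spherically symmetric metric $$ds^2=-f(r)\,dt^2+\frac{dr^2}{f(r)}+r^2(d\theta^2+\sin^2\theta\, d\phi^2),\qquad f(r)=1-\frac{2M(r)}{r},\qquad r\in[0,\infty),$$ with one of the following mass functions: (Bardeen) $M(r)=\dfrac{mr^3}{(r^2+l^2)^{3/2}}$; (Hayward) $M(r)=\dfrac{mr^3}{r^3+2ml^2}$; (Dymnikova) $M(r)=\dfrac{2m}{\pi}\left\{\arctan\left(\dfrac{r}{l}\right)-\dfrac{lr}{r^2+l^2}\right\}$; (Fan-Wang) $M(r)=\dfrac{mr^3}{(r+l)^3}$. Let $\tilde T_{\mu\nu}:=G_{\mu\nu}$ be the effective energy-momentum tensor. Then in all four spacetimes the null energy condition (NEC) and the weak energy condition (WEC) hold everywhere. Moreover: - Bardeen: the dominant energy condition (DEC) holds exactly in the region $0\le r\le 2l$, and the strong energy condition (SEC) holds exactly in the region $r\ge\sqrt{2/3}\,l$. - Hayward: the DEC holds exactly in the region $0\le r\le(4ml^2)^{1/3}$, and the SEC holds exactly in the region $r\ge (ml^2)^{1/3}$. - Dymnikova: the DEC holds everywhere, and the SEC holds exactly in the region $r\ge l$. - Fan-Wang: the DEC holds everywhere, and the SEC holds exactly in the region $r\ge l$. In particular, the Bardeen and Hayward spacetimes violate the DEC in the asymptotically flat region $r\to\infty$, whereas the Dymnikova and Fan-Wang spacetimes satisfy all four energy conditions there.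
   Context: Signature $(-,+,+,+)$; $G_{\mu\nu}$ is the Einstein tensor of the metric (units $c=8\pi G=1$). The energy conditions at a point for $\tilde T_{\mu\nu}$ are: - NEC: $\tilde T_{\mu\nu}k^\mu k^\nu\ge0$ for all null $k^\mu$. - WEC: $\tilde T_{\mu\nu}v^\mu v^\nu\ge0$ for all timelike $v^\mu$. - DEC: $\tilde T_{\mu\nu}v^\mu v^\nu\ge0$ and $J_\mu J^\mu\le0$ for all timelike $v^\mu$, where $J^\mu:=-\tilde T^\mu{}_\nu v^\nu$. - SEC: $(\tilde T_{\mu\nu}-\tfrac12\tilde T g_{\mu\nu})v^\mu v^\nu\ge0$ for all timelike $v^\mu$. If in an orthonormal frame $\tilde T^{(a)(b)}=\mathrm{diag}(\rho,p_1,p_2,p_3)$, these are equivalent to (for all $i$): NEC: $\rho+p_i\ge0$; WEC: NEC and $\rho\ge0$; DEC: WEC and $\rho-p_i\ge0$; SEC: NEC and $\rho+p_1+p_2+p_3\ge0$. Points with $f(r)=0$ (Killing horizons) are only coordinate singularities; there the tensor is that of the regular extension of the metric across the horizon (e.g. in Painlev\'e-Gullstrand coordinates). At $r=0$ the conditions are understood for the limiting values as $r\to0$. *)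

theory Defs
  imports "HOL-Analysis.Analysis"
begin

section \<open>Curvature of a metric given in coordinates\<close>

text \<open>A metric on a coordinate patch is a map \<open>g\<close> sending a coordinate vector \<open>x\<close> to the matrix
  of the components with both indices down. All index positions below follow the usual notation, e.g.
  \<open>christoffel g a b c\<close> has \<open>a\<close> upstairs and \<open>b\<close>, \<open>c\<close> downstairs.\<close>

definition partial_deriv :: "'n::finite \<Rightarrow> (real^'n \<Rightarrow> real) \<Rightarrow> real^'n \<Rightarrow> real" where
  "partial_deriv i F x = deriv (\<lambda>s. F (x + s *\<^sub>R axis i 1)) 0"

definition christoffel :: "(real^'n \<Rightarrow> real^'n^'n) \<Rightarrow> 'n::finite \<Rightarrow> 'n \<Rightarrow> 'n \<Rightarrow> real^'n \<Rightarrow> real" where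
  "christoffel g a b c x = (1/2) * (\<Sum>d\<in>UNIV. matrix_inv (g x) $ a $ d *
     (partial_deriv b (\<lambda>y. g y $ d $ c) x + partial_deriv c (\<lambda>y. g y $ d $ b) x
      - partial_deriv d (\<lambda>y. g y $ b $ c) x))"

definition riemann ::
  "(real^'n \<Rightarrow> real^'n^'n) \<Rightarrow> 'n::finite \<Rightarrow> 'n \<Rightarrow> 'n \<Rightarrow> 'n \<Rightarrow> real^'n \<Rightarrow> real" where
  "riemann g a b c d x =
     partial_deriv c (christoffel g a d b) x - partial_deriv d (christoffel g a c b) x
     + (\<Sum>e\<in>UNIV. christoffel g a c e x * christoffel g e d b x)
     - (\<Sum>e\<in>UNIV. christoffel g a d e x * christoffel g e c b x)"

definition ricci :: "(real^'n \<Rightarrow> real^'n^'n) \<Rightarrow> real^'n \<Rightarrow> real^'n^'n::finite" where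
  "ricci g x = (\<chi> b d. \<Sum>a\<in>UNIV. riemann g a b a d x)"

text \<open>Here \<open>G\<close> is the matrix of the metric at one point, and \<open>T\<close> that of a tensor with both indices
  down; the result is the trace of \<open>T\<close> with respect to the inverse metric.\<close>

definition metric_trace :: "real^'n^'n \<Rightarrow> real^'n^'n \<Rightarrow> real" where
  "metric_trace G T = (\<Sum>a\<in>UNIV. \<Sum>b\<in>UNIV. matrix_inv G $ a $ b * T $ a $ b)"

definition einstein :: "(real^'n \<Rightarrow> real^'n^'n) \<Rightarrow> real^'n \<Rightarrow> real^'n^'n::finite" where
  "einstein g x = ricci g x - (metric_trace (g x) (ricci g x) / 2) *\<^sub>R g x"


section \<open>Energy conditions at a point, signature (-,+,+,+)\<close>

definition nullvec :: "real^4^4 \<Rightarrow> real^4 \<Rightarrow> bool" where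
  "nullvec G k \<longleftrightarrow> k \<bullet> (G *v k) = 0"

definition timelike :: "real^4^4 \<Rightarrow> real^4 \<Rightarrow> bool" where
  "timelike G v \<longleftrightarrow> v \<bullet> (G *v v) < 0"

definition NEC :: "real^4^4 \<Rightarrow> real^4^4 \<Rightarrow> bool" where
  "NEC G T \<longleftrightarrow> (\<forall>k. nullvec G k \<longrightarrow> k \<bullet> (T *v k) \<ge> 0)"

definition WEC :: "real^4^4 \<Rightarrow> real^4^4 \<Rightarrow> bool" where
  "WEC G T \<longleftrightarrow> (\<forall>v. timelike G v \<longrightarrow> v \<bullet> (T *v v) \<ge> 0)"

definition energy_flux :: "real^4^4 \<Rightarrow> real^4^4 \<Rightarrow> real^4 \<Rightarrow> real^4" where
  "energy_flux G T v = - (matrix_inv G *v (T *v v))"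

definition DEC :: "real^4^4 \<Rightarrow> real^4^4 \<Rightarrow> bool" where
  "DEC G T \<longleftrightarrow> (\<forall>v. timelike G v \<longrightarrow> v \<bullet> (T *v v) \<ge> 0 \<and>
     energy_flux G T v \<bullet> (G *v energy_flux G T v) \<le> 0)"

definition SEC :: "real^4^4 \<Rightarrow> real^4^4 \<Rightarrow> bool" where
  "SEC G T \<longleftrightarrow> (\<forall>v. timelike G v \<longrightarrow> v \<bullet> ((T - (metric_trace G T / 2) *\<^sub>R G) *v v) \<ge> 0)"


section \<open>The spherically symmetric spacetime with mass function \<open>M\<close>\<close>

text \<open>Coordinates: component 1 is the time, 2 is \<open>r\<close>, 3 is \<open>\<theta>\<close>, 4 is \<open>\<phi>\<close>.\<close>

definition metric_f :: "(real \<Rightarrow> real) \<Rightarrow> real \<Rightarrow> real" where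
  "metric_f M r = 1 - 2 * M r / r"

definition static_metric :: "(real \<Rightarrow> real) \<Rightarrow> real^4 \<Rightarrow> real^4^4" where
  "static_metric M x = (let r = x $ 2; \<theta> = x $ 3 in
     vector [vector [- metric_f M r, 0,                0,    0],
             vector [0,              1 / metric_f M r, 0,    0],
             vector [0,              0,                r^2,  0],
             vector [0,              0,                0,    r^2 * (sin \<theta>)^2]])"

text \<open>The same spacetime in Painleve-Gullstrand coordinates, with time
  \<open>dT = dt + sqrt (1 - f) / f dr\<close>; this is regular where \<open>f = 0\<close>.\<close>

definition pg_metric :: "(real \<Rightarrow> real) \<Rightarrow> real^4 \<Rightarrow> real^4^4" where
  "pg_metric M x = (let r = x $ 2; \<theta> = x $ 3 in
     vector [vector [- metric_f M r,          sqrt (1 - metric_f M r), 0,   0],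
             vector [sqrt (1 - metric_f M r), 1,                       0,   0],
             vector [0,                       0,                       r^2, 0],
             vector [0,                       0,                       0,   r^2 * (sin \<theta>)^2]])"

definition minkowski :: "real^4^4" where
  "minkowski = vector [vector [-1, 0, 0, 0], vector [0, 1, 0, 0],
                       vector [0, 0, 1, 0], vector [0, 0, 0, 1]]"

text \<open>The orthonormal frame of the static coordinates where \<open>f > 0\<close>; for the mass functions below
  this covers a neighbourhood of the centre.\<close>

definition static_frame :: "(real \<Rightarrow> real) \<Rightarrow> real^4 \<Rightarrow> 4 \<Rightarrow> real^4" where
  "static_frame M x a = (let r = x $ 2; \<theta> = x $ 3 in
     axis a (vector [1 / sqrt (metric_f M r), sqrt (metric_f M r), 1 / r, 1 / (r * sin \<theta>)] $ a))"

definition frame_components :: "(4 \<Rightarrow> real^4) \<Rightarrow> real^4^4 \<Rightarrow> real^4^4" where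
  "frame_components e T = (\<chi> a b. e a \<bullet> (T *v e b))"

text \<open>\<open>C\<close> is one of the four energy conditions and the tensor is the Einstein tensor. On a horizon
  \<open>t\<close> is the Painleve-Gullstrand time; at \<open>r = 0\<close> the tensor is the limit of the orthonormal
  components along the radial line.\<close>

definition condition_at ::
  "(real \<Rightarrow> real) \<Rightarrow> (real^4^4 \<Rightarrow> real^4^4 \<Rightarrow> bool) \<Rightarrow> real \<Rightarrow> real \<Rightarrow> real \<Rightarrow> real \<Rightarrow> bool" where
  "condition_at M C t r \<theta> \<phi> =
    (if r = 0 then
       (\<exists>L. ((\<lambda>s. let x = vector [t, s, \<theta>, \<phi>] in
                frame_components (static_frame M x) (einstein (static_metric M) x)) \<longlongrightarrow> L) (at_right 0)
            \<and> C minkowski L)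
     else let x = vector [t, r, \<theta>, \<phi>] in
       if metric_f M r = 0 then C (pg_metric M x) (einstein (pg_metric M) x)
       else C (static_metric M x) (einstein (static_metric M) x))"

text \<open>The poles of the sphere are excluded: they are only a singularity of the angular chart, and every
  point of the sphere is off the poles for another choice of the axis.\<close>

definition holds_exactly ::
  "(real \<Rightarrow> real) \<Rightarrow> (real^4^4 \<Rightarrow> real^4^4 \<Rightarrow> bool) \<Rightarrow> real set \<Rightarrow> bool" where
  "holds_exactly M C R \<longleftrightarrow> (\<forall>t r \<theta> \<phi>. r \<ge> 0 \<longrightarrow> 0 < \<theta> \<longrightarrow> \<theta> < pi \<longrightarrow>
     (condition_at M C t r \<theta> \<phi> \<longleftrightarrow> r \<in> R))"

definition holds_everywhere ::
  "(real \<Rightarrow> real) \<Rightarrow> (real^4^4 \<Rightarrow> real^4^4 \<Rightarrow> bool) \<Rightarrow> bool" where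
  "holds_everywhere M C \<longleftrightarrow> (\<forall>t r \<theta> \<phi>. r \<ge> 0 \<longrightarrow> 0 < \<theta> \<longrightarrow> \<theta> < pi \<longrightarrow> condition_at M C t r \<theta> \<phi>)"

definition holds_asymptotically ::
  "(real \<Rightarrow> real) \<Rightarrow> (real^4^4 \<Rightarrow> real^4^4 \<Rightarrow> bool) \<Rightarrow> bool" where
  "holds_asymptotically M C \<longleftrightarrow> (\<forall>\<^sub>F r in at_top. \<forall>t \<theta> \<phi>. 0 < \<theta> \<longrightarrow> \<theta> < pi \<longrightarrow>
     condition_at M C t r \<theta> \<phi>)"

definition violated_asymptotically ::
  "(real \<Rightarrow> real) \<Rightarrow> (real^4^4 \<Rightarrow> real^4^4 \<Rightarrow> bool) \<Rightarrow> bool" where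
  "violated_asymptotically M C \<longleftrightarrow> (\<forall>\<^sub>F r in at_top. \<forall>t \<theta> \<phi>. 0 < \<theta> \<longrightarrow> \<theta> < pi \<longrightarrow>
     \<not> condition_at M C t r \<theta> \<phi>)"


section \<open>The mass functions\<close>

definition bardeen :: "real \<Rightarrow> real \<Rightarrow> real \<Rightarrow> real" where
  "bardeen m l r = m * r^3 / (r^2 + l^2) powr (3/2)"

definition hayward :: "real \<Rightarrow> real \<Rightarrow> real \<Rightarrow> real" where
  "hayward m l r = m * r^3 / (r^3 + 2 * m * l^2)"

definition dymnikova :: "real \<Rightarrow> real \<Rightarrow> real \<Rightarrow> real" where
  "dymnikova m l r = (2 * m / pi) * (arctan (r / l) - l * r / (r^2 + l^2))"

definition fan_wang :: "real \<Rightarrow> real \<Rightarrow> real \<Rightarrow> real" where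
  "fan_wang m l r = m * r^3 / (r + l)^3"

end

(* In both coordinate systems the (t, r) block of the metric has determinant -1, and the Einstein
   tensor is -rho times this block plus p times the angular block, with rho = 2 M' / r^2 and
   p = - M'' / r. A timelike vector has radial norm -alpha and angular norm beta with
   0 <= beta < alpha, arbitrary otherwise, so each energy condition becomes a pair of linear
   inequalities in rho and p. For the four mass functions rho > 0 and rho + p >= 0, so the DEC
   reduces to p <= rho and the SEC to p >= 0. *)

theory Submission
  imports Defs
begin

text \<open>The obstacle is that \<open>condition_at\<close> has three branches: a limit in a frame
  at the centre, Painleve-Gullstrand coordinates on a horizon, static coordinates elsewhere,
  including regions with f < 0 where r is the timelike coordinate. To compute curvature only once,
  the radial block is kept general, with entries -f, s, h subject to f h + s^2 = 1. Its inverse is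
  then free of division, and the curvature identities in this block follow from that relation and
  its derivative. Since the tensor is a multiple of the metric on the radial block, no step has to
  know which radial direction is timelike, so all branches lead to the same inequalities in \<rho>
  and p.

  Regularity enters twice. Positive density makes M increase from M(0) = 0, so 1 - f > 0 and the
  square root in the Painleve-Gullstrand form is differentiable for every r > 0. And M'(0) = 0
  forces f > 0 near the centre, where the limiting frame is used.\<close>

section \<open>Block matrices and partial derivatives in coordinates\<close>

lemma vector_4 [simp]:
  "(vector [x, y, z, w] :: 'a::zero^4) $ 1 = x"
  "(vector [x, y, z, w] :: 'a::zero^4) $ 2 = y"
  "(vector [x, y, z, w] :: 'a::zero^4) $ 3 = z"
  "(vector [x, y, z, w] :: 'a::zero^4) $ 4 = w"
  unfolding vector_def by simp_all

lemma matrix_inv_unique: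
  fixes A B :: "'a::semiring_1^'n^'n"
  assumes "A ** B = mat 1" "B ** A = mat 1"
  shows "matrix_inv A = B"
proof -
  have "A ** matrix_inv A = mat 1 \<and> matrix_inv A ** A = mat 1"
    unfolding matrix_inv_def by (rule someI[of _ B]) (use assms in blast)
  then show ?thesis
    by (metis assms(2) matrix_mul_assoc matrix_mul_lid matrix_mul_rid)
qed

text \<open>The common shape of both metrics, their inverses, and their Ricci and Einstein tensors;
  \<open>b\<close> is the dt dr cross term that the Painleve-Gullstrand form brings in.\<close>

definition block4 :: "real \<Rightarrow> real \<Rightarrow> real \<Rightarrow> real \<Rightarrow> real \<Rightarrow> real^4^4" where
  "block4 a b c A B = vector [vector [a, b, 0, 0], vector [b, c, 0, 0],
                              vector [0, 0, A, 0], vector [0, 0, 0, B]]"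

text \<open>With determinant -1 the inverse of the radial block is minus its adjugate, so nothing is
  divided by the entries and zeros of f are harmless.\<close>

lemma matrix_inv_block4:
  assumes "a * c - b\<^sup>2 = -1" "A \<noteq> 0" "B \<noteq> 0"
  shows "matrix_inv (block4 a b c A B) = block4 (- c) b (- a) (1 / A) (1 / B)"
  using assms
  by (intro matrix_inv_unique)
     (simp_all add: block4_def vec_eq_iff forall_4 matrix_matrix_mult_def sum_4 mat_def
        power2_eq_square algebra_simps)

text \<open>The closed form of the Christoffel symbols is known only inside the chart, so agreement
  with \<Phi> is asked only on an open set of radii and angles; a derivative along an axis sees no
  more than a neighbourhood. Moving along axis 1 or 4 changes neither coordinate.\<close>

lemma partial_deriv_symmetric:
  fixes F :: "real^4 \<Rightarrow> real"
  assumes U: "open U" "x $ 2 \<in> U" and V: "open V" "x $ 3 \<in> V"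
    and F: "\<And>y. y $ 2 \<in> U \<Longrightarrow> y $ 3 \<in> V \<Longrightarrow> F y = \<Phi> (y $ 2) (y $ 3)"
  shows "partial_deriv 1 F x = 0" "partial_deriv 4 F x = 0"
    "((\<lambda>r. \<Phi> r (x $ 3)) has_real_derivative D) (at (x $ 2)) \<Longrightarrow> partial_deriv 2 F x = D"
    "((\<lambda>\<theta>. \<Phi> (x $ 2) \<theta>) has_real_derivative D) (at (x $ 3)) \<Longrightarrow> partial_deriv 3 F x = D"
proof -
  show "partial_deriv 1 F x = 0" "partial_deriv 4 F x = 0"
    using F[of "x + s *\<^sub>R axis 1 1" for s] F[of "x + s *\<^sub>R axis 4 1" for s] U V
    by (simp_all add: partial_deriv_def axis_def)
next
  assume D: "((\<lambda>r. \<Phi> r (x $ 3)) has_real_derivative D) (at (x $ 2))"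
  have "((\<lambda>s. \<Phi> (x $ 2 + s) (x $ 3)) has_real_derivative D) (at 0)"
    using D DERIV_shift[of "\<lambda>r. \<Phi> r (x $ 3)" D 0 "x $ 2"] by (simp add: add.commute)
  moreover have "((\<lambda>s. x $ 2 + s) \<longlongrightarrow> x $ 2 + 0) (nhds 0)"
    by (intro tendsto_intros filterlim_ident)
  then have "\<forall>\<^sub>F s in nhds 0. x $ 2 + s \<in> U"
    using U by (auto dest: topological_tendstoD)
  then have "\<forall>\<^sub>F s in nhds 0. F (x + s *\<^sub>R axis 2 1) = \<Phi> (x $ 2 + s) (x $ 3)"
    by eventually_elim (use F V in \<open>simp add: axis_def\<close>)
  ultimately show "partial_deriv 2 F x = D"
    unfolding partial_deriv_def by (subst deriv_cong_ev[OF _ refl]) (auto intro: DERIV_imp_deriv)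
next
  assume D: "((\<lambda>\<theta>. \<Phi> (x $ 2) \<theta>) has_real_derivative D) (at (x $ 3))"
  have "((\<lambda>s. \<Phi> (x $ 2) (x $ 3 + s)) has_real_derivative D) (at 0)"
    using D DERIV_shift[of "\<lambda>r. \<Phi> (x $ 2) r" D 0 "x $ 3"] by (simp add: add.commute)
  moreover have "((\<lambda>s. x $ 3 + s) \<longlongrightarrow> x $ 3 + 0) (nhds 0)"
    by (intro tendsto_intros filterlim_ident)
  then have "\<forall>\<^sub>F s in nhds 0. x $ 3 + s \<in> V"
    using V by (auto dest: topological_tendstoD)
  then have "\<forall>\<^sub>F s in nhds 0. F (x + s *\<^sub>R axis 3 1) = \<Phi> (x $ 2) (x $ 3 + s)"
    by eventually_elim (use F U in \<open>simp add: axis_def\<close>)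
  ultimately show "partial_deriv 3 F x = D"
    unfolding partial_deriv_def by (subst deriv_cong_ev[OF _ refl]) (auto intro: DERIV_imp_deriv)
qed

section \<open>The Einstein tensor of a spherically symmetric metric\<close>

text \<open>\<open>s = 0\<close> gives the static and \<open>h = 1\<close> the Painleve-Gullstrand form of the metric. Second
  derivatives of \<open>s\<close> and \<open>h\<close> could only come from the \<open>r\<close>-derivative of the Christoffel symbol
  \<open>t; rr\<close>, which does not enter the Ricci tensor.\<close>

locale spherical_metric =
  fixes f f' f'' s s' h h' :: "real \<Rightarrow> real" and U :: "real set"
  assumes U: "open U" "\<And>r. r \<in> U \<Longrightarrow> r \<noteq> 0"
    and det: "\<And>r. r \<in> U \<Longrightarrow> f r * h r + (s r)\<^sup>2 = 1"
    and f: "\<And>r. r \<in> U \<Longrightarrow> (f has_real_derivative f' r) (at r)"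
    and f': "\<And>r. r \<in> U \<Longrightarrow> (f' has_real_derivative f'' r) (at r)"
    and s: "\<And>r. r \<in> U \<Longrightarrow> (s has_real_derivative s' r) (at r)"
    and h: "\<And>r. r \<in> U \<Longrightarrow> (h has_real_derivative h' r) (at r)"
begin

definition g :: "real^4 \<Rightarrow> real^4^4" where
  "g x = (let r = x $ 2; \<theta> = x $ 3 in block4 (- f r) (s r) (h r) (r\<^sup>2) (r\<^sup>2 * (sin \<theta>)\<^sup>2))"

definition V :: "real set" where "V = {\<theta>. sin \<theta> \<noteq> 0}"

lemma V: "open V"
  unfolding V_def by (intro open_Collect_neq continuous_intros)

definition g_r :: "real \<Rightarrow> real \<Rightarrow> real^4^4" where
  "g_r r \<theta> = block4 (- f' r) (s' r) (h' r) (2 * r) (2 * r * (sin \<theta>)\<^sup>2)"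

definition g_\<theta> :: "real \<Rightarrow> real \<Rightarrow> real^4^4" where
  "g_\<theta> r \<theta> = block4 0 0 0 0 (2 * r\<^sup>2 * sin \<theta> * cos \<theta>)"

lemma partial_deriv_g:
  assumes x: "x $ 2 \<in> U" "x $ 3 \<in> V"
  shows "partial_deriv 1 (\<lambda>y. g y $ a $ b) x = 0" "partial_deriv 4 (\<lambda>y. g y $ a $ b) x = 0"
    "partial_deriv 2 (\<lambda>y. g y $ a $ b) x = g_r (x $ 2) (x $ 3) $ a $ b"
    "partial_deriv 3 (\<lambda>y. g y $ a $ b) x = g_\<theta> (x $ 2) (x $ 3) $ a $ b"
proof -
  define \<Phi> where "\<Phi> r \<theta> = block4 (- f r) (s r) (h r) (r\<^sup>2) (r\<^sup>2 * (sin \<theta>)\<^sup>2) $ a $ b" for r \<theta>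
  note P = partial_deriv_symmetric[OF U(1) x(1) V x(2), of "\<lambda>y. g y $ a $ b" \<Phi>]
  show "partial_deriv 1 (\<lambda>y. g y $ a $ b) x = 0" "partial_deriv 4 (\<lambda>y. g y $ a $ b) x = 0"
    by (rule P; simp add: g_def \<Phi>_def Let_def)+
  have "\<forall>a b. ((\<lambda>r. block4 (- f r) (s r) (h r) (r\<^sup>2) (r\<^sup>2 * (sin (x $ 3))\<^sup>2) $ a $ b)
      has_real_derivative g_r (x $ 2) (x $ 3) $ a $ b) (at (x $ 2))"
    using x by (simp add: g_r_def forall_4 block4_def) (auto intro!: derivative_eq_intros f s h)
  then show "partial_deriv 2 (\<lambda>y. g y $ a $ b) x = g_r (x $ 2) (x $ 3) $ a $ b"
    by (intro P) (simp_all add: g_def \<Phi>_def Let_def)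
  have "\<forall>a b. ((\<lambda>\<theta>. block4 (- f (x $ 2)) (s (x $ 2)) (h (x $ 2)) ((x $ 2)\<^sup>2) ((x $ 2)\<^sup>2 * (sin \<theta>)\<^sup>2) $ a $ b)
      has_real_derivative g_\<theta> (x $ 2) (x $ 3) $ a $ b) (at (x $ 3))"
    using x by (simp add: g_\<theta>_def forall_4 block4_def) (auto intro!: derivative_eq_intros)
  then show "partial_deriv 3 (\<lambda>y. g y $ a $ b) x = g_\<theta> (x $ 2) (x $ 3) $ a $ b"
    by (intro P) (simp_all add: g_def \<Phi>_def Let_def)
qed

text \<open>The closed form of the Christoffel symbols, upper index first. The symbol r;rr is by
  definition s s' + f h' / 2; it is entered as - h f' / 2, so that its r-derivative does not involve
  second derivatives of s and h.\<close>

definition \<Gamma> :: "real \<Rightarrow> real \<Rightarrow> real^4^4^4" where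
  "\<Gamma> r \<theta> = vector [
     block4 (s r * f' r / 2) (h r * f' r / 2) (s r * h' r / 2 - h r * s' r) (- s r * r) (- s r * r * (sin \<theta>)\<^sup>2),
     block4 (f r * f' r / 2) (- s r * f' r / 2) (- h r * f' r / 2) (- f r * r) (- f r * r * (sin \<theta>)\<^sup>2),
     vector [0, vector [0, 0, 1 / r, 0], vector [0, 1 / r, 0, 0], vector [0, 0, 0, - sin \<theta> * cos \<theta>]],
     vector [0, vector [0, 0, 0, 1 / r], vector [0, 0, 0, cos \<theta> / sin \<theta>], vector [0, 1 / r, cos \<theta> / sin \<theta>, 0]]]"

text \<open>The determinant relation holds on an open set and may be differentiated there. This is
  the link that trades s' and h' for f'.\<close>

lemma det_deriv:
  assumes "r \<in> U"
  shows "f' r * h r + f r * h' r + 2 * s r * s' r = 0"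
proof -
  have "((\<lambda>r. f r * h r + (s r)\<^sup>2) has_real_derivative f' r * h r + f r * h' r + 2 * s r * s' r) (at r)"
    using assms by (auto intro!: derivative_eq_intros f s h)
  moreover have "((\<lambda>r. f r * h r + (s r)\<^sup>2) has_real_derivative 0) (at r)"
    by (subst has_field_derivative_cong_eventually[of _ "\<lambda>_. 1"])
       (use assms det in \<open>auto intro: eventually_mono[OF eventually_at_in_open'[OF U(1)]]\<close>)
  ultimately show ?thesis by (rule DERIV_unique)
qed

lemma matrix_inv_g:
  assumes x: "x $ 2 \<in> U" "x $ 3 \<in> V"
  shows "matrix_inv (g x) = block4 (- h (x $ 2)) (s (x $ 2)) (f (x $ 2)) (1 / (x $ 2)\<^sup>2)
    (1 / ((x $ 2)\<^sup>2 * (sin (x $ 3))\<^sup>2))"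
  unfolding g_def Let_def
  using det[OF x(1)] U(2)[OF x(1)] x(2) by (subst matrix_inv_block4) (simp_all add: V_def)

lemma christoffel_g:
  assumes x: "x $ 2 \<in> U" "x $ 3 \<in> V"
  shows "christoffel g a b c x = \<Gamma> (x $ 2) (x $ 3) $ a $ b $ c"
proof -
  have "\<forall>a b c. christoffel g a b c x = \<Gamma> (x $ 2) (x $ 3) $ a $ b $ c"
    using det_deriv[OF x(1)] U(2)[OF x(1)] x(2)
    unfolding christoffel_def \<Gamma>_def matrix_inv_g[OF x] sum_4 forall_4 partial_deriv_g[OF x]
    by (simp add: block4_def g_r_def g_\<theta>_def V_def power2_eq_square)
       (simp add: field_simps; algebra)
  then show ?thesis by blast
qed

text \<open>The mixed Ricci tensor has the double eigenvalues \<open>- Q\<close> on the radial block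
  and \<open>S\<close> on the angular block.\<close>

definition Q :: "real \<Rightarrow> real" where "Q r = f'' r / 2 + f' r / r"
definition S :: "real \<Rightarrow> real" where "S r = (1 - f r - r * f' r) / r\<^sup>2"

lemma partial_deriv_\<Gamma>:
  assumes x: "x $ 2 \<in> U" "x $ 3 \<in> V"
  shows "partial_deriv 1 (christoffel g a b c) x = 0" "partial_deriv 4 (christoffel g a b c) x = 0"
    "((\<lambda>r. \<Gamma> r (x $ 3) $ a $ b $ c) has_real_derivative D) (at (x $ 2)) \<Longrightarrow>
       partial_deriv 2 (christoffel g a b c) x = D"
    "((\<lambda>\<theta>. \<Gamma> (x $ 2) \<theta> $ a $ b $ c) has_real_derivative D) (at (x $ 3)) \<Longrightarrow>
       partial_deriv 3 (christoffel g a b c) x = D"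
  using partial_deriv_symmetric[OF U(1) x(1) V x(2), of "christoffel g a b c"
      "\<lambda>r \<theta>. \<Gamma> r \<theta> $ a $ b $ c"] christoffel_g by auto

text \<open>The r-derivatives of the symbols with r upstairs, for which the Ricci tensor needs all
  pairs of lower indices.\<close>

definition \<Gamma>2_r :: "real \<Rightarrow> real \<Rightarrow> real^4^4" where
  "\<Gamma>2_r r \<theta> = block4 (((f' r)\<^sup>2 + f r * f'' r) / 2) (- (s' r * f' r + s r * f'' r) / 2)
     (- (h' r * f' r + h r * f'' r) / 2) (- f' r * r - f r) ((- f' r * r - f r) * (sin \<theta>)\<^sup>2)"

lemma ricci_g:
  assumes x: "x $ 2 \<in> U" "x $ 3 \<in> V"
  defines "r \<equiv> x $ 2" and "\<theta> \<equiv> x $ 3"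
  shows "ricci g x = block4 (Q r * f r) (- Q r * s r) (- Q r * h r) (S r * r\<^sup>2) (S r * r\<^sup>2 * (sin \<theta>)\<^sup>2)"
proof -
  have rU: "r \<in> U" and r0: "r \<noteq> 0" and sin0: "sin \<theta> \<noteq> 0"
    using x U by (auto simp: r_def \<theta>_def V_def)
  note P = partial_deriv_\<Gamma>[OF x, folded r_def \<theta>_def]
  \<comment> \<open>The Ricci tensor differentiates only the divergence, by coordinate a of symbols
    with a upstairs, and the contracted symbols a;ab. With t upstairs an r-derivative therefore
    meets only t;tb, never t;rr.\<close>
  have d1: "partial_deriv 2 (christoffel g 1 1 1) x = (s' r * f' r + s r * f'' r) / 2"
    "partial_deriv 2 (christoffel g 1 1 2) x = (h' r * f' r + h r * f'' r) / 2"
    "partial_deriv 2 (christoffel g 1 1 3) x = 0" "partial_deriv 2 (christoffel g 1 1 4) x = 0"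
    by (rule P; use rU in \<open>auto simp: \<Gamma>_def block4_def intro!: derivative_eq_intros f f' s h\<close>)+
  have "\<forall>b c. ((\<lambda>r. \<Gamma> r \<theta> $ 2 $ b $ c) has_real_derivative \<Gamma>2_r r \<theta> $ b $ c) (at r)"
    using rU by (simp add: \<Gamma>_def \<Gamma>2_r_def block4_def forall_4)
      (auto intro!: derivative_eq_intros f f' s h simp: field_simps power2_eq_square)
  then have d2: "partial_deriv 2 (christoffel g 2 b c) x = \<Gamma>2_r r \<theta> $ b $ c" for b c
    by (intro P) auto
  have d3: "partial_deriv 2 (christoffel g 3 3 1) x = 0"
    "partial_deriv 2 (christoffel g 3 3 2) x = - 1 / r\<^sup>2"
    "partial_deriv 2 (christoffel g 3 3 3) x = 0" "partial_deriv 2 (christoffel g 3 3 4) x = 0"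
    "partial_deriv 2 (christoffel g 4 4 1) x = 0"
    "partial_deriv 2 (christoffel g 4 4 2) x = - 1 / r\<^sup>2"
    "partial_deriv 2 (christoffel g 4 4 3) x = 0" "partial_deriv 2 (christoffel g 4 4 4) x = 0"
    by (rule P; use r0 in \<open>auto simp: \<Gamma>_def block4_def power2_eq_square intro!: derivative_eq_intros\<close>)+
  have "((\<lambda>\<theta>. cos \<theta> / sin \<theta>) has_real_derivative
      (- sin \<theta> * sin \<theta> - cos \<theta> * cos \<theta>) / (sin \<theta> * sin \<theta>)) (at \<theta>)"
    by (intro DERIV_divide DERIV_sin DERIV_cos sin0)
  moreover have "- sin \<theta> * sin \<theta> - cos \<theta> * cos \<theta> = -1"
    using sin_cos_squared_add3[of \<theta>] by linarith
  ultimately have cot: "((\<lambda>\<theta>. cos \<theta> / sin \<theta>) has_real_derivative - 1 / (sin \<theta>)\<^sup>2) (at \<theta>)"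
    by (simp only: power2_eq_square)
  have d4: "partial_deriv 3 (christoffel g 1 1 b) x = 0"
    "partial_deriv 3 (christoffel g 2 2 b) x = 0"
    "partial_deriv 3 (christoffel g 4 4 b) x = (if b = 3 then - 1 / (sin \<theta>)\<^sup>2 else 0)"
    "partial_deriv 3 (christoffel g 3 b c) x = (if b = 4 \<and> c = 4 then (sin \<theta>)\<^sup>2 - (cos \<theta>)\<^sup>2 else 0)" for b c
  proof -
    have "\<forall>b. ((\<lambda>\<theta>. \<Gamma> r \<theta> $ 1 $ 1 $ b) has_real_derivative 0) (at \<theta>)"
      by (simp add: \<Gamma>_def block4_def forall_4)
    then show "partial_deriv 3 (christoffel g 1 1 b) x = 0" by (intro P) auto
    have "\<forall>b. ((\<lambda>\<theta>. \<Gamma> r \<theta> $ 2 $ 2 $ b) has_real_derivative 0) (at \<theta>)"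
      by (simp add: \<Gamma>_def block4_def forall_4)
    then show "partial_deriv 3 (christoffel g 2 2 b) x = 0" by (intro P) auto
    have "\<forall>b. ((\<lambda>\<theta>. \<Gamma> r \<theta> $ 4 $ 4 $ b) has_real_derivative
        (if b = 3 then - 1 / (sin \<theta>)\<^sup>2 else 0)) (at \<theta>)"
      using cot by (simp add: \<Gamma>_def block4_def forall_4)
    then show "partial_deriv 3 (christoffel g 4 4 b) x = (if b = 3 then - 1 / (sin \<theta>)\<^sup>2 else 0)"
      by (intro P) auto
    have "\<forall>b c. ((\<lambda>\<theta>. \<Gamma> r \<theta> $ 3 $ b $ c) has_real_derivative
        (if b = 4 \<and> c = 4 then (sin \<theta>)\<^sup>2 - (cos \<theta>)\<^sup>2 else 0)) (at \<theta>)"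
      by (auto simp: \<Gamma>_def block4_def forall_4 power2_eq_square intro!: derivative_eq_intros)
    then show "partial_deriv 3 (christoffel g 3 b c) x =
        (if b = 4 \<and> c = 4 then (sin \<theta>)\<^sup>2 - (cos \<theta>)\<^sup>2 else 0)"
      by (intro P) auto
  qed
  have C: "christoffel g a b c x = \<Gamma> r \<theta> $ a $ b $ c" for a b c
    using christoffel_g[OF x] by (simp add: r_def \<theta>_def)
  have cos: "(cos \<theta>)\<^sup>2 = 1 - (sin \<theta>)\<^sup>2"
    by (simp add: cos_squared_eq)
  \<comment> \<open>Once denominators are cleared, the components not settled by simplification are
    polynomial consequences of the determinant relation and its derivative.\<close>
  show ?thesis
    using r0 sin0
    unfolding ricci_def riemann_def vec_eq_iff forall_4 sum_4
    by (simp add: P d1 d2 d3 d4, simp add: C \<Gamma>_def \<Gamma>2_r_def block4_def Q_def S_def,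
        intro conjI; simp add: field_simps power2_eq_square)
      (use det_deriv[OF rU] det[OF rU, unfolded power2_eq_square] in algebra)+
qed

text \<open>The scalar curvature is 2 (S - Q), and subtracting half of it turns the eigenvalues -Q,
  S into -S, Q. So \<open>S\<close> is the density and \<open>Q\<close> the tangential
  pressure.\<close>

lemma einstein_g:
  assumes x: "x $ 2 \<in> U" "x $ 3 \<in> V"
  defines "r \<equiv> x $ 2" and "\<theta> \<equiv> x $ 3"
  shows "einstein g x = block4 (S r * f r) (- S r * s r) (- S r * h r)
    (Q r * r\<^sup>2) (Q r * (r\<^sup>2 * (sin \<theta>)\<^sup>2))"
proof -
  have trace: "metric_trace (g x) (ricci g x) = 2 * (S r - Q r)"
    using det[OF x(1)] U(2)[OF x(1)] x(2)
    unfolding metric_trace_def matrix_inv_g[OF x] ricci_g[OF x] r_def \<theta>_def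
    by (simp add: sum_4 block4_def V_def power2_eq_square) algebra
  show ?thesis
    unfolding einstein_def trace
    unfolding ricci_g[OF x] g_def Let_def r_def \<theta>_def
    by (simp add: vec_eq_iff forall_4 block4_def algebra_simps) (simp add: field_simps)
qed

end

section \<open>Energy conditions for \<open>diag(\<rho>, - \<rho>, p, p)\<close>\<close>

lemma quadratic_block4:
  "v \<bullet> (block4 a b c A B *v v) =
     (a * (v $ 1)\<^sup>2 + 2 * b * v $ 1 * v $ 2 + c * (v $ 2)\<^sup>2) + (A * (v $ 3)\<^sup>2 + B * (v $ 4)\<^sup>2)"
  by (simp add: inner_vec_def matrix_vector_mult_def sum_4 block4_def power2_eq_square algebra_simps)

text \<open>The radial pressure is -\<rho>, which makes T invariant under radial boosts; hence no
  orthonormal frame is needed and only the determinant of the radial block is prescribed. The signs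
  of \<open>a\<close> and \<open>c\<close> stay free, which covers horizons and regions with f <
  0.\<close>

definition vacuum_like_fluid :: "real^4^4 \<Rightarrow> real^4^4 \<Rightarrow> real \<Rightarrow> real \<Rightarrow> bool" where
  "vacuum_like_fluid G T \<rho> p \<longleftrightarrow> (\<exists>a b c A B. a * c - b\<^sup>2 = -1 \<and> A > 0 \<and> B > 0 \<and>
     G = block4 a b c A B \<and> T = block4 (- \<rho> * a) (- \<rho> * b) (- \<rho> * c) (p * A) (p * B))"

lemma lorentzian_negative:
  fixes a b c :: real
  assumes "a * c - b\<^sup>2 = -1"
  obtains x y where "a * x\<^sup>2 + 2 * b * x * y + c * y\<^sup>2 < 0"
proof -
  consider "a < 0" | "c > 0" | "c < 0" | "a \<ge> 0" "c = 0" by linarith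
  then show ?thesis
  proof cases
    case 1
    then show ?thesis using that[of 1 0] by simp
  next
    case 2
    \<comment> \<open>The vector (c, -b) is orthogonal to the second axis; its norm is c times the
      determinant, that is -c.\<close>
    have "a * c\<^sup>2 + 2 * b * c * (- b) + c * (- b)\<^sup>2 = c * (a * c - b\<^sup>2)" by algebra
    then show ?thesis using that[of c "- b"] assms 2 by simp
  next
    case 3
    then show ?thesis using that[of 0 1] by simp
  next
    case 4
    with assms have b2: "b\<^sup>2 = 1" by simp
    \<comment> \<open>With c = 0 the form is affine in y for x = 1. Since b^2 = 1, this choice of y
      gives -a - 2.\<close>
    have "a * 1\<^sup>2 + 2 * b * 1 * (- b * (a + 1)) + c * (- b * (a + 1))\<^sup>2 = a - 2 * b\<^sup>2 * (a + 1)"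
      using 4 by (simp add: power2_eq_square algebra_simps)
    also have "\<dots> < 0" using b2 4 by simp
    finally show ?thesis by (rule that)
  qed
qed

text \<open>The two norms can be prescribed independently: rescale a radial vector of negative norm,
  and put all of the angular norm into the \<theta> direction.\<close>

lemma causal_witness:
  fixes a b c A B \<alpha> \<beta> :: real
  assumes "a * c - b\<^sup>2 = -1" "A > 0" "\<alpha> \<ge> 0" "\<beta> \<ge> 0"
  obtains v :: "real^4" where "a * (v $ 1)\<^sup>2 + 2 * b * v $ 1 * v $ 2 + c * (v $ 2)\<^sup>2 = - \<alpha>"
    "A * (v $ 3)\<^sup>2 + B * (v $ 4)\<^sup>2 = \<beta>"
proof -
  obtain x y where xy: "a * x\<^sup>2 + 2 * b * x * y + c * y\<^sup>2 < 0"
    using lorentzian_negative[OF assms(1)] .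
  define q k where "q = a * x\<^sup>2 + 2 * b * x * y + c * y\<^sup>2" and "k = sqrt (\<alpha> / - q)"
  have "q < 0" using xy by (simp only: q_def)
  then have k: "k\<^sup>2 * q = - \<alpha>" using assms(3) by (simp add: k_def divide_nonneg_neg)
  have "a * (k * x)\<^sup>2 + 2 * b * (k * x) * (k * y) + c * (k * y)\<^sup>2 = k\<^sup>2 * q"
    unfolding q_def by algebra
  moreover have "A * (sqrt (\<beta> / A))\<^sup>2 = \<beta>" using assms by simp
  ultimately show ?thesis
    using that[of "vector [k * x, k * y, sqrt (\<beta> / A), 0]"] k by simp
qed

text \<open>The cone is spanned by the rays (1, 0) and (1, 1), and a linear form is tested on these.
  The second ray lies on the excluded boundary, so its inequality comes from the limit \<beta> to 1
  from below.\<close>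

lemma cone_nonneg_iff:
  fixes \<rho> p :: real
  shows "(\<forall>\<alpha> \<beta>. 0 \<le> \<beta> \<and> \<beta> < \<alpha> \<longrightarrow> \<rho> * \<alpha> + p * \<beta> \<ge> 0) \<longleftrightarrow> \<rho> \<ge> 0 \<and> \<rho> + p \<ge> 0"
proof safe
  assume *: "\<forall>\<alpha> \<beta>. 0 \<le> \<beta> \<and> \<beta> < \<alpha> \<longrightarrow> \<rho> * \<alpha> + p * \<beta> \<ge> 0"
  show "\<rho> \<ge> 0" using *[rule_format, of 0 1] by simp
  have "((\<lambda>\<beta>. \<rho> * 1 + p * \<beta>) \<longlongrightarrow> \<rho> * 1 + p * 1) (at_left 1)"
    by (intro tendsto_intros)
  moreover have "\<forall>\<^sub>F \<beta> in at_left (1::real). \<rho> * 1 + p * \<beta> \<ge> 0"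
    using eventually_at_left_real[OF zero_less_one] by eventually_elim (use * in \<open>simp del: mult_1_right\<close>)
  ultimately show "\<rho> + p \<ge> 0"
    using tendsto_lowerbound by fastforce
next
  fix \<alpha> \<beta> :: real
  assume *: "0 \<le> \<rho>" "0 \<le> \<rho> + p" "0 \<le> \<beta>" "\<beta> < \<alpha>"
  have "\<rho> * \<alpha> + p * \<beta> = \<rho> * (\<alpha> - \<beta>) + (\<rho> + p) * \<beta>" by algebra
  then show "0 \<le> \<rho> * \<alpha> + p * \<beta>" using * by simp
qed

lemma energy_conditions_fluid:
  assumes "vacuum_like_fluid G T \<rho> p"
  shows "NEC G T \<longleftrightarrow> \<rho> + p \<ge> 0"
    and "WEC G T \<longleftrightarrow> \<rho> \<ge> 0 \<and> \<rho> + p \<ge> 0"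
    and "DEC G T \<longleftrightarrow> \<rho> + p \<ge> 0 \<and> \<rho> - p \<ge> 0"
    and "SEC G T \<longleftrightarrow> p \<ge> 0 \<and> \<rho> + p \<ge> 0"
proof -
  obtain a b c A B where det: "a * c - b\<^sup>2 = -1" and AB: "A > 0" "B > 0"
    and G: "G = block4 a b c A B"
    and T: "T = block4 (- \<rho> * a) (- \<rho> * b) (- \<rho> * c) (p * A) (p * B)"
    using assms unfolding vacuum_like_fluid_def by blast
  define \<alpha> \<beta> :: "real^4 \<Rightarrow> real"
    where "\<alpha> v = - (a * (v $ 1)\<^sup>2 + 2 * b * v $ 1 * v $ 2 + c * (v $ 2)\<^sup>2)"
      and "\<beta> v = A * (v $ 3)\<^sup>2 + B * (v $ 4)\<^sup>2" for v
  have \<beta>: "\<beta> v \<ge> 0" for v using AB by (simp add: \<beta>_def)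
  have witness: "\<exists>v. \<alpha> v = x \<and> \<beta> v = y" if "x \<ge> 0" "y \<ge> 0" for x y
    using causal_witness[OF det AB(1) that, of B] unfolding \<alpha>_def \<beta>_def by (metis minus_minus)
  have qG: "v \<bullet> (G *v v) = \<beta> v - \<alpha> v" for v
    by (simp add: G quadratic_block4 \<alpha>_def \<beta>_def)
  have qT: "v \<bullet> (T *v v) = \<rho> * \<alpha> v + p * \<beta> v" for v
    by (simp add: T quadratic_block4 \<alpha>_def \<beta>_def algebra_simps)
  \<comment> \<open>The pairs (\<alpha> v, \<beta> v) fill the whole closed quadrant, so quantifying
    over timelike vectors amounts to quantifying over the cone.\<close>
  have timelike: "(\<forall>v. timelike G v \<longrightarrow> P (\<alpha> v) (\<beta> v)) \<longleftrightarrow>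
      (\<forall>x y. 0 \<le> y \<and> y < x \<longrightarrow> P x y)" for P
    unfolding timelike_def qG using \<beta> witness
    by (smt (verit, best))
  have inv: "matrix_inv G = block4 (- c) b (- a) (1 / A) (1 / B)"
    unfolding G by (rule matrix_inv_block4) (use det AB in auto)

  show "NEC G T \<longleftrightarrow> \<rho> + p \<ge> 0"
  proof
    assume *: "NEC G T"
    obtain v where "\<alpha> v = 1" "\<beta> v = 1" using witness[of 1 1] by auto
    moreover have "\<beta> v - \<alpha> v = 0 \<longrightarrow> 0 \<le> \<rho> * \<alpha> v + p * \<beta> v"
      using * unfolding NEC_def nullvec_def qG qT by blast
    ultimately show "\<rho> + p \<ge> 0" by simp
  next
    assume "\<rho> + p \<ge> 0"
    then show "NEC G T" unfolding NEC_def nullvec_def qG qT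
      using \<beta> by (auto simp flip: distrib_right) (metis mult_nonneg_nonneg)
  qed

  show wec: "WEC G T \<longleftrightarrow> \<rho> \<ge> 0 \<and> \<rho> + p \<ge> 0"
    unfolding WEC_def qT timelike[of "\<lambda>x y. 0 \<le> \<rho> * x + p * y"] by (rule cone_nonneg_iff)

  \<comment> \<open>Raising an index makes T act as -\<rho> on the radial and p on the angular
    components. The flux therefore has norms scaled by \<rho>^2 and p^2, and its causality is again
    a cone condition, now with coefficients \<rho>^2 and -p^2.\<close>
  have flux: "energy_flux G T v = vector [\<rho> * v $ 1, \<rho> * v $ 2, - p * v $ 3, - p * v $ 4]" for v
    unfolding energy_flux_def inv T using det AB
    by (simp add: vec_eq_iff forall_4 matrix_vector_mult_def sum_4 block4_def power2_eq_square)
       (intro conjI; algebra)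
  have "energy_flux G T v \<bullet> (G *v energy_flux G T v) = - (\<rho>\<^sup>2 * \<alpha> v + (- p\<^sup>2) * \<beta> v)" for v
    unfolding qG unfolding flux \<alpha>_def \<beta>_def by (simp add: power2_eq_square algebra_simps)
  then have "DEC G T \<longleftrightarrow> WEC G T \<and> (\<forall>v. timelike G v \<longrightarrow> \<rho>\<^sup>2 * \<alpha> v + (- p\<^sup>2) * \<beta> v \<ge> 0)"
    unfolding DEC_def WEC_def by auto
  also have "\<dots> \<longleftrightarrow> \<rho> \<ge> 0 \<and> \<rho> + p \<ge> 0 \<and> p\<^sup>2 \<le> \<rho>\<^sup>2"
    unfolding wec timelike[of "\<lambda>x y. 0 \<le> \<rho>\<^sup>2 * x + (- p\<^sup>2) * y"] cone_nonneg_iff by simp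
  also have "\<dots> \<longleftrightarrow> \<rho> + p \<ge> 0 \<and> \<rho> - p \<ge> 0"
    by (auto simp flip: abs_le_square_iff)
  finally show "DEC G T \<longleftrightarrow> \<rho> + p \<ge> 0 \<and> \<rho> - p \<ge> 0" .

  have trace: "metric_trace G T / 2 = p - \<rho>"
    unfolding metric_trace_def inv T using det AB
    by (simp add: sum_4 block4_def power2_eq_square) algebra
  \<comment> \<open>Trace reversal exchanges the roles of \<rho> and p, so the same cone lemma
    applies with its arguments swapped.\<close>
  have "v \<bullet> ((T - (metric_trace G T / 2) *\<^sub>R G) *v v) = p * \<alpha> v + \<rho> * \<beta> v" for v
    unfolding trace
    by (simp add: matrix_vector_mult_diff_rdistrib scaleR_matrix_vector_assoc[symmetric]
        inner_diff_right qT qG algebra_simps)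
  then show "SEC G T \<longleftrightarrow> p \<ge> 0 \<and> \<rho> + p \<ge> 0"
    unfolding SEC_def using timelike[of "\<lambda>x y. 0 \<le> p * x + \<rho> * y"] cone_nonneg_iff[of p \<rho>]
    by (simp add: add.commute)
qed

section \<open>Regular mass functions\<close>

text \<open>M' and M'' are prescribed through \<rho> and p, so continuity of these two at 0 yields
  the limiting tensor at the centre. The first derivative is required at r = 0 as well, where it
  vanishes; the second only for r > 0.\<close>

locale regular_mass_function =
  fixes M \<rho> p :: "real \<Rightarrow> real"
  assumes M_0: "M 0 = 0"
    and M_deriv: "\<And>r. r \<ge> 0 \<Longrightarrow> (M has_real_derivative \<rho> r * r\<^sup>2 / 2) (at r)"
    and M_deriv2: "\<And>r. r > 0 \<Longrightarrow> ((\<lambda>r. \<rho> r * r\<^sup>2 / 2) has_real_derivative - r * p r) (at r)"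
    and \<rho>_pos: "\<And>r. r \<ge> 0 \<Longrightarrow> \<rho> r > 0"
    and cont_0: "isCont \<rho> 0" "isCont p 0"
begin

text \<open>M' is left as \<open>\<rho> r * r\<^sup>2 / 2\<close> without cancelling, to match the
  function whose derivative \<open>M_deriv2\<close> supplies.\<close>

definition f' :: "real \<Rightarrow> real" where "f' r = 2 * M r / r\<^sup>2 - 2 * (\<rho> r * r\<^sup>2 / 2) / r"
definition f'' :: "real \<Rightarrow> real" where "f'' r = 2 * \<rho> r + 2 * p r - 4 * M r / r ^ 3"

lemma f_deriv: "r > 0 \<Longrightarrow> (metric_f M has_real_derivative f' r) (at r)"
  unfolding metric_f_def[abs_def] f'_def
  by (auto intro!: derivative_eq_intros M_deriv simp: field_simps power2_eq_square)

lemma f'_deriv: "r > 0 \<Longrightarrow> (f' has_real_derivative f'' r) (at r)"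
proof -
  assume r: "r > 0"
  define \<mu> where "\<mu> r = \<rho> r * r\<^sup>2 / 2" for r
  have \<mu>: "(\<mu> has_real_derivative - r * p r) (at r)"
    unfolding \<mu>_def[abs_def] by (rule M_deriv2[OF r])
  have M: "(M has_real_derivative \<mu> r) (at r)"
    unfolding \<mu>_def using r by (intro M_deriv) simp
  have "((\<lambda>r. 2 * M r / r\<^sup>2 - 2 * \<mu> r / r) has_real_derivative
      (2 * \<mu> r / r\<^sup>2 - 4 * M r / r ^ 3) - (2 * (- r * p r) / r - 2 * \<mu> r / r\<^sup>2)) (at r)"
    using r by (auto intro!: derivative_eq_intros M \<mu> simp: field_simps power2_eq_square power3_eq_cube)
  moreover have "(2 * \<mu> r / r\<^sup>2 - 4 * M r / r ^ 3) - (2 * (- r * p r) / r - 2 * \<mu> r / r\<^sup>2) = f'' r"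
    using r by (simp add: f''_def \<mu>_def)
  ultimately show ?thesis unfolding f'_def[abs_def] \<mu>_def[symmetric] by simp
qed

text \<open>M' > 0 for r > 0, starting from M(0) = 0. This keeps 1 - f = 2 M / r positive, so the
  Painleve-Gullstrand chart is available for all r > 0, horizons included.\<close>

lemma M_pos:
  assumes "r > 0"
  shows "M r > 0"
proof -
  have "M 0 < M r"
  proof (rule DERIV_pos_imp_increasing_open[OF assms])
    show "\<exists>y. (M has_real_derivative y) (at x) \<and> 0 < y" if "0 < x" "x < r" for x
      using that M_deriv[of x] \<rho>_pos[of x] by (intro exI[of _ "\<rho> x * x\<^sup>2 / 2"]) auto
    show "continuous_on {0..r} M"
      by (rule DERIV_continuous_on[of _ _ "\<lambda>r. \<rho> r * r\<^sup>2 / 2"])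
         (auto intro: DERIV_subset M_deriv)
  qed
  then show ?thesis by (simp add: M_0)
qed

lemma open_static: "open {r. r > 0 \<and> metric_f M r \<noteq> 0}"
proof -
  have "continuous_on {0<..} (metric_f M)"
    by (rule DERIV_continuous_on[of _ _ f']) (auto intro: DERIV_subset f_deriv)
  then have "open ({0<..} \<inter> metric_f M -` (- {0}))"
    by (rule continuous_open_preimage) auto
  also have "{0<..} \<inter> metric_f M -` (- {0}) = {r. r > 0 \<and> metric_f M r \<noteq> 0}" by auto
  finally show ?thesis .
qed

sublocale static: spherical_metric "metric_f M" f' f'' "\<lambda>_. 0" "\<lambda>_. 0" "\<lambda>r. 1 / metric_f M r"
  "\<lambda>r. - f' r / (metric_f M r)\<^sup>2" "{r. r > 0 \<and> metric_f M r \<noteq> 0}"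
  by unfold_locales
     (auto intro!: open_static f_deriv f'_deriv derivative_eq_intros simp: power2_eq_square)

sublocale pg: spherical_metric "metric_f M" f' f'' "\<lambda>r. sqrt (1 - metric_f M r)"
  "\<lambda>r. - f' r / (2 * sqrt (1 - metric_f M r))" "\<lambda>_. 1" "\<lambda>_. 0" "{0<..}"
proof unfold_locales
  fix r :: real assume r: "r \<in> {0<..}"
  then have pos: "1 - metric_f M r > 0" using M_pos by (simp add: metric_f_def)
  then show "metric_f M r * 1 + (sqrt (1 - metric_f M r))\<^sup>2 = 1" by simp
  show "((\<lambda>r. sqrt (1 - metric_f M r)) has_real_derivative
      - f' r / (2 * sqrt (1 - metric_f M r))) (at r)"
    using r pos by (auto intro!: derivative_eq_intros f_deriv simp: field_simps)
qed (auto intro: f_deriv f'_deriv)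

lemma static_g: "static.g = static_metric M"
  by (simp add: static.g_def static_metric_def block4_def Let_def fun_eq_iff)

lemma pg_g: "pg.g = pg_metric M"
  by (simp add: pg.g_def pg_metric_def block4_def Let_def fun_eq_iff)

text \<open>For f = 1 - 2 M / r the undifferentiated M cancels: 1 - f - r f' = 2 M' and f'' / 2 + f'
  / r = - M'' / r.\<close>

lemma Q_S:
  assumes "r > 0"
  shows "static.Q r = p r" "static.S r = \<rho> r" "pg.Q r = p r" "pg.S r = \<rho> r"
  using assms unfolding static.Q_def static.S_def pg.Q_def pg.S_def f''_def f'_def metric_f_def
  by (simp_all add: field_simps power2_eq_square power3_eq_cube)

lemma einstein_static:
  assumes "r > 0" "metric_f M r \<noteq> 0" "sin \<theta> \<noteq> 0"
  shows "einstein (static_metric M) (vector [t, r, \<theta>, \<phi>]) =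
    block4 (\<rho> r * metric_f M r) 0 (- \<rho> r / metric_f M r) (p r * r\<^sup>2) (p r * (r\<^sup>2 * (sin \<theta>)\<^sup>2))"
  using static.einstein_g[of "vector [t, r, \<theta>, \<phi>]"] assms
  by (simp add: static_g static.V_def Q_S)

lemma einstein_pg:
  assumes "r > 0" "sin \<theta> \<noteq> 0"
  shows "einstein (pg_metric M) (vector [t, r, \<theta>, \<phi>]) =
    block4 (\<rho> r * metric_f M r) (- \<rho> r * sqrt (1 - metric_f M r)) (- \<rho> r)
      (p r * r\<^sup>2) (p r * (r\<^sup>2 * (sin \<theta>)\<^sup>2))"
  using pg.einstein_g[of "vector [t, r, \<theta>, \<phi>]"] assms
  by (simp add: pg_g pg.V_def Q_S)

lemma frame_components_static:
  fixes t \<phi> :: real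
  assumes "r > 0" "metric_f M r > 0" "sin \<theta> > 0"
  defines "x \<equiv> vector [t, r, \<theta>, \<phi>]"
  shows "frame_components (static_frame M x) (einstein (static_metric M) x) =
    block4 (\<rho> r) 0 (- \<rho> r) (p r) (p r)"
  unfolding x_def einstein_static[OF assms(1) less_imp_neq[OF assms(2), symmetric]
      less_imp_neq[OF assms(3), symmetric]]
  using assms(1-3)
  by (simp add: frame_components_def static_frame_def Let_def vec_eq_iff forall_4 block4_def
      matrix_vector_mult_def inner_vec_def sum_4 axis_def power2_eq_square
      mult.left_commute[of "sqrt (metric_f M r)" "\<rho> r"])

text \<open>M(r) / r is the difference quotient of M at 0 and tends to M'(0) = 0, so f tends to
  1.\<close>

lemma eventually_metric_f_pos: "\<forall>\<^sub>F r in at_right 0. metric_f M r > 0"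
proof -
  have "((\<lambda>r. M r / r) \<longlongrightarrow> 0) (at 0)"
    using M_deriv[of 0] by (simp add: has_field_derivative_iff M_0)
  then have "((\<lambda>r. M r / r) \<longlongrightarrow> 0) (at_right 0)"
    by (rule filterlim_mono) (auto simp: at_le)
  then have "\<forall>\<^sub>F r in at_right 0. M r / r < 1 / 2"
    by (rule order_tendstoD) simp
  then show ?thesis by eventually_elim (simp add: metric_f_def mult.commute)
qed

lemma frame_components_at_centre:
  assumes "sin \<theta> > 0"
  shows "((\<lambda>r. let x = vector [t, r, \<theta>, \<phi>] in
      frame_components (static_frame M x) (einstein (static_metric M) x)) \<longlongrightarrow>
    block4 (\<rho> 0) 0 (- \<rho> 0) (p 0) (p 0)) (at_right 0)"
proof -
  have "(\<rho> \<longlongrightarrow> \<rho> 0) (at_right 0)" "(p \<longlongrightarrow> p 0) (at_right 0)"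
    using cont_0 unfolding isCont_def by (auto intro: filterlim_mono simp: at_le)
  then have "\<forall>a b. ((\<lambda>r. block4 (\<rho> r) 0 (- \<rho> r) (p r) (p r) $ a $ b) \<longlongrightarrow>
      block4 (\<rho> 0) 0 (- \<rho> 0) (p 0) (p 0) $ a $ b) (at_right 0)"
    by (auto simp: forall_4 block4_def intro: tendsto_intros)
  then have "((\<lambda>r. block4 (\<rho> r) 0 (- \<rho> r) (p r) (p r)) \<longlongrightarrow>
      block4 (\<rho> 0) 0 (- \<rho> 0) (p 0) (p 0)) (at_right 0)"
    by (intro vec_tendstoI) auto
  moreover have "\<forall>\<^sub>F r in at_right 0. block4 (\<rho> r) 0 (- \<rho> r) (p r) (p r) =
      (let x = vector [t, r, \<theta>, \<phi>] in
      frame_components (static_frame M x) (einstein (static_metric M) x))"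
    using eventually_metric_f_pos eventually_at_right_less[of 0]
    by eventually_elim (simp add: Let_def frame_components_static assms)
  ultimately show ?thesis by (rule Lim_transform_eventually)
qed

text \<open>Merges the three branches of \<open>condition_at\<close>. \<open>G\<close> and
  \<open>T\<close> are chosen before \<open>C\<close>, so one pair serves all four
  conditions.\<close>

lemma condition_at_fluid:
  assumes "r \<ge> 0" "0 < \<theta>" "\<theta> < pi"
  obtains G T where "vacuum_like_fluid G T (\<rho> r) (p r)"
    "\<And>C. condition_at M C t r \<theta> \<phi> \<longleftrightarrow> C G T"
proof -
  have sin: "sin \<theta> > 0" using assms by (simp add: sin_gt_zero)
  define x :: "real^4" where "x = vector [t, r, \<theta>, \<phi>]"
  consider "r = 0" | "r > 0" "metric_f M r = 0" | "r > 0" "metric_f M r \<noteq> 0"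
    using assms by fastforce
  then show ?thesis
  proof cases
    case 1
    let ?L = "block4 (\<rho> 0) 0 (- \<rho> 0) (p 0) (p 0)"
    have "vacuum_like_fluid minkowski ?L (\<rho> r) (p r)"
      unfolding vacuum_like_fluid_def
      by (rule exI[of _ "-1"], rule exI[of _ 0], rule exI[of _ 1], rule exI[of _ 1], rule exI[of _ 1])
         (simp add: minkowski_def block4_def 1)
    \<comment> \<open>Uniqueness of limits identifies the existentially quantified tensor at the
      centre with \<open>?L\<close>.\<close>
    moreover have "condition_at M C t r \<theta> \<phi> \<longleftrightarrow> C minkowski ?L" for C
      using frame_components_at_centre[OF sin, of t \<phi>]
      unfolding condition_at_def 1 by (auto dest: tendsto_unique[OF trivial_limit_at_right_real])
    ultimately show ?thesis by (rule that)
  next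
    case 2
    have "vacuum_like_fluid (pg_metric M x) (einstein (pg_metric M) x) (\<rho> r) (p r)"
      unfolding vacuum_like_fluid_def
      by (rule exI[of _ "- metric_f M r"], rule exI[of _ "sqrt (1 - metric_f M r)"], rule exI[of _ 1],
          rule exI[of _ "r\<^sup>2"], rule exI[of _ "r\<^sup>2 * (sin \<theta>)\<^sup>2"])
         (use 2 sin in \<open>simp add: x_def einstein_pg pg_metric_def block4_def Let_def\<close>)
    moreover have "condition_at M C t r \<theta> \<phi> \<longleftrightarrow> C (pg_metric M x) (einstein (pg_metric M) x)" for C
      using 2 by (simp add: condition_at_def x_def Let_def)
    ultimately show ?thesis by (rule that)
  next
    case 3
    have "vacuum_like_fluid (static_metric M x) (einstein (static_metric M) x) (\<rho> r) (p r)"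
      unfolding vacuum_like_fluid_def
      by (rule exI[of _ "- metric_f M r"], rule exI[of _ 0], rule exI[of _ "1 / metric_f M r"],
          rule exI[of _ "r\<^sup>2"], rule exI[of _ "r\<^sup>2 * (sin \<theta>)\<^sup>2"])
         (use 3 sin in \<open>simp add: x_def einstein_static static_metric_def block4_def Let_def\<close>)
    moreover have "condition_at M C t r \<theta> \<phi> \<longleftrightarrow> C (static_metric M x) (einstein (static_metric M) x)" for C
      using 3 by (simp add: condition_at_def x_def Let_def)
    ultimately show ?thesis by (rule that)
  qed
qed

lemma condition_at_iff:
  assumes "r \<ge> 0" "0 < \<theta>" "\<theta> < pi"
  shows "condition_at M NEC t r \<theta> \<phi> \<longleftrightarrow> \<rho> r + p r \<ge> 0"
    and "condition_at M WEC t r \<theta> \<phi> \<longleftrightarrow> \<rho> r + p r \<ge> 0"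
    and "condition_at M DEC t r \<theta> \<phi> \<longleftrightarrow> \<rho> r + p r \<ge> 0 \<and> \<rho> r - p r \<ge> 0"
    and "condition_at M SEC t r \<theta> \<phi> \<longleftrightarrow> p r \<ge> 0 \<and> \<rho> r + p r \<ge> 0"
proof -
  obtain G T where pf: "vacuum_like_fluid G T (\<rho> r) (p r)"
    and C: "\<And>C. condition_at M C t r \<theta> \<phi> \<longleftrightarrow> C G T"
    using condition_at_fluid[OF assms, of t \<phi>] by blast
  show "condition_at M NEC t r \<theta> \<phi> \<longleftrightarrow> \<rho> r + p r \<ge> 0"
    "condition_at M WEC t r \<theta> \<phi> \<longleftrightarrow> \<rho> r + p r \<ge> 0"
    "condition_at M DEC t r \<theta> \<phi> \<longleftrightarrow> \<rho> r + p r \<ge> 0 \<and> \<rho> r - p r \<ge> 0"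
    "condition_at M SEC t r \<theta> \<phi> \<longleftrightarrow> p r \<ge> 0 \<and> \<rho> r + p r \<ge> 0"
    unfolding C energy_conditions_fluid[OF pf] using \<rho>_pos[OF assms(1)] by auto
qed

end


section \<open>From pointwise inequalities to regions of radii\<close>

lemma (in regular_mass_function) holds_everywhere_NEC_WEC:
  assumes "\<And>r. r \<ge> 0 \<Longrightarrow> \<rho> r + p r \<ge> 0"
  shows "holds_everywhere M NEC" "holds_everywhere M WEC"
  using assms by (auto simp: holds_everywhere_def condition_at_iff)

lemma (in regular_mass_function) holds_exactly_DEC_SEC:
  assumes "\<And>r. r \<ge> 0 \<Longrightarrow> \<rho> r + p r \<ge> 0"
  shows "(\<And>r. r \<ge> 0 \<Longrightarrow> \<rho> r - p r \<ge> 0 \<longleftrightarrow> r \<in> R) \<Longrightarrow> holds_exactly M DEC R"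
    "(\<And>r. r \<ge> 0 \<Longrightarrow> p r \<ge> 0 \<longleftrightarrow> r \<in> R) \<Longrightarrow> holds_exactly M SEC R"
  using assms by (auto simp: holds_exactly_def condition_at_iff)

lemma holds_everywhere_iff_exactly: "holds_everywhere M C \<longleftrightarrow> holds_exactly M C {0..}"
  by (auto simp: holds_everywhere_def holds_exactly_def)

lemma holds_exactly_imp_asymptotically:
  assumes "holds_exactly M C {a..}"
  shows "holds_asymptotically M C"
  unfolding holds_asymptotically_def
  using eventually_ge_at_top[of a] eventually_ge_at_top[of 0]
  by eventually_elim (use assms in \<open>auto simp: holds_exactly_def\<close>)

lemma holds_exactly_imp_violated_asymptotically:
  assumes "holds_exactly M C {0..a}"
  shows "violated_asymptotically M C"
  unfolding violated_asymptotically_def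
  using eventually_gt_at_top[of a] eventually_ge_at_top[of 0]
  by eventually_elim (use assms in \<open>auto simp: holds_exactly_def\<close>)

lemma scaled_nonneg_iff:
  fixes K x D :: real
  assumes "K > 0" "D > 0"
  shows "K * x / D \<ge> 0 \<longleftrightarrow> x \<ge> 0"
  using assms by (auto simp: zero_le_divide_iff zero_le_mult_iff)

section \<open>The four spacetimes\<close>

context
  fixes m l :: real
  assumes pos: "l > 0" "m > 0"
begin

text \<open>Trades \<open>powr (3/2)\<close> for the cube of a square root, so that the derivative
  identities become polynomial in r and q.\<close>

definition q where "q r = sqrt (r\<^sup>2 + l\<^sup>2)"

lemma q_pos: "q r > 0"
  using pos by (simp add: q_def add_nonneg_pos)

lemma q_deriv: "(q has_real_derivative r / q r) (at r)"
  using q_pos[of r] unfolding q_def[abs_def]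
  by (auto intro!: derivative_eq_intros simp: field_simps)

lemma bardeen_eq: "bardeen m l r = m * r ^ 3 / q r ^ 3"
proof -
  have "(r\<^sup>2 + l\<^sup>2) powr (3 / 2) = ((r\<^sup>2 + l\<^sup>2) powr (1 / 2)) powr 3"
    by (simp add: powr_powr)
  also have "\<dots> = q r powr (real 3)"
    by (simp add: powr_half_sqrt q_def)
  also have "\<dots> = q r ^ 3"
    by (rule powr_realpow[OF q_pos])
  finally show ?thesis by (simp add: bardeen_def)
qed

text \<open>Obtained from M' = 3 m l^2 r^2 / q^5. Here and for the other three mass functions the
  powers of r in 2 M' / r^2 and - M'' / r are cancelled, so that the formulas are continuous at the
  centre.\<close>

definition bardeen_\<rho> where "bardeen_\<rho> r = 6 * m * l\<^sup>2 / q r ^ 5"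
definition bardeen_p where "bardeen_p r = 3 * m * l\<^sup>2 * (3 * r\<^sup>2 - 2 * l\<^sup>2) / q r ^ 7"

lemma regular_bardeen: "regular_mass_function (bardeen m l) bardeen_\<rho> bardeen_p"
proof
  fix r :: real
  note q = q_pos[of r]
  \<comment> \<open>Eliminating l^2 leaves r and q as independent variables, and the square root
    disappears from the identities.\<close>
  have q2: "l\<^sup>2 = (q r)\<^sup>2 - r\<^sup>2" by (simp add: q_def)
  have "((\<lambda>r. m * r ^ 3 / q r ^ 3) has_real_derivative
     (3 * m * r\<^sup>2 * q r ^ 3 - m * r ^ 3 * (3 * (q r)\<^sup>2 * (r / q r))) / (q r ^ 3 * q r ^ 3)) (at r)"
    using q by (auto intro!: derivative_eq_intros q_deriv)
  then show "(bardeen m l has_real_derivative bardeen_\<rho> r * r\<^sup>2 / 2) (at r)"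
    unfolding bardeen_eq[abs_def]
    by (rule DERIV_cong) (use q in \<open>simp add: bardeen_\<rho>_def, simp add: q2 field_simps, algebra\<close>)
  have "((\<lambda>r. 6 * m * l\<^sup>2 / q r ^ 5 * r\<^sup>2 / 2) has_real_derivative
     6 * m * l\<^sup>2 * (2 * r * q r ^ 5 - r\<^sup>2 * (5 * q r ^ 4 * (r / q r))) / (q r ^ 5 * q r ^ 5) / 2) (at r)"
    using q by (auto intro!: derivative_eq_intros q_deriv) (simp add: field_simps)
  then show "((\<lambda>r. bardeen_\<rho> r * r\<^sup>2 / 2) has_real_derivative - r * bardeen_p r) (at r)"
    unfolding bardeen_\<rho>_def[abs_def]
    by (rule DERIV_cong) (use q in \<open>simp add: bardeen_p_def, simp add: q2 field_simps, algebra\<close>)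
  show "bardeen_\<rho> r > 0"
    using q pos by (simp add: bardeen_\<rho>_def)
next
  show "isCont bardeen_\<rho> 0" "isCont bardeen_p 0"
    unfolding bardeen_\<rho>_def[abs_def] bardeen_p_def[abs_def] using pos
    by (auto intro!: continuous_intros DERIV_isCont[OF q_deriv] simp: q_def)
qed (simp add: bardeen_def)

definition hayward_\<rho> where "hayward_\<rho> r = 12 * m\<^sup>2 * l\<^sup>2 / (r ^ 3 + 2 * m * l\<^sup>2)\<^sup>2"
definition hayward_p where
  "hayward_p r = 24 * m\<^sup>2 * l\<^sup>2 * (r ^ 3 - m * l\<^sup>2) / (r ^ 3 + 2 * m * l\<^sup>2) ^ 3"

lemma hayward_denominator_pos: "r \<ge> 0 \<Longrightarrow> r ^ 3 + 2 * m * l\<^sup>2 > 0"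
  using pos by (simp add: add_nonneg_pos)

lemma regular_hayward: "regular_mass_function (hayward m l) hayward_\<rho> hayward_p"
proof
  fix r :: real
  define q where "q = r ^ 3 + 2 * m * l\<^sup>2"
  {
    \<comment> \<open>The denominator r^3 + 2 m l^2 vanishes at a negative radius, so its positivity
      has to be drawn from the sign of r.\<close>
    assume "r \<ge> 0"
    then have q: "q > 0" using hayward_denominator_pos by (simp add: q_def)
    have "((\<lambda>r. m * r ^ 3 / (r ^ 3 + 2 * m * l\<^sup>2)) has_real_derivative
       (3 * m * r\<^sup>2 * q - m * r ^ 3 * (3 * r\<^sup>2)) / (q * q)) (at r)"
      using q by (auto intro!: derivative_eq_intros simp flip: q_def)
    then show "(hayward m l has_real_derivative hayward_\<rho> r * r\<^sup>2 / 2) (at r)"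
      unfolding hayward_def[abs_def]
      by (rule DERIV_cong) (use q in \<open>simp add: hayward_\<rho>_def power2_eq_square flip: q_def, simp add: q_def algebra_simps power2_eq_square power3_eq_cube\<close>)
    show "hayward_\<rho> r > 0"
      using q pos by (simp add: hayward_\<rho>_def flip: q_def)
  }
  assume "r > 0"
  then have q: "q > 0" using hayward_denominator_pos by (simp add: q_def)
  have "((\<lambda>r. 12 * m\<^sup>2 * l\<^sup>2 / (r ^ 3 + 2 * m * l\<^sup>2)\<^sup>2 * r\<^sup>2 / 2) has_real_derivative
      6 * m\<^sup>2 * l\<^sup>2 * (2 * r * q\<^sup>2 - r\<^sup>2 * (2 * q * (3 * r\<^sup>2))) / (q\<^sup>2 * q\<^sup>2)) (at r)"
    using q by (auto intro!: derivative_eq_intros simp flip: q_def) (simp add: field_simps)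
  then show "((\<lambda>r. hayward_\<rho> r * r\<^sup>2 / 2) has_real_derivative - r * hayward_p r) (at r)"
    unfolding hayward_\<rho>_def[abs_def]
    by (rule DERIV_cong) (use q in \<open>simp add: hayward_p_def flip: q_def, simp add: field_simps, simp add: q_def, algebra\<close>)
next
  show "isCont hayward_\<rho> 0" "isCont hayward_p 0"
    unfolding hayward_\<rho>_def[abs_def] hayward_p_def[abs_def] using pos
    by (auto intro!: continuous_intros)
qed (simp add: hayward_def)

definition dymnikova_\<rho> where "dymnikova_\<rho> r = 8 * m * l / pi / (r\<^sup>2 + l\<^sup>2)\<^sup>2"
definition dymnikova_p where "dymnikova_p r = 8 * m * l / pi * (r\<^sup>2 - l\<^sup>2) / (r\<^sup>2 + l\<^sup>2) ^ 3"

lemma regular_dymnikova: "regular_mass_function (dymnikova m l) dymnikova_\<rho> dymnikova_p"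
proof
  fix r :: real
  define q where "q = r\<^sup>2 + l\<^sup>2"
  have q: "q > 0" using pos by (simp add: q_def add_nonneg_pos)
  have "1 + (r / l)\<^sup>2 = q / l\<^sup>2" using pos by (simp add: q_def field_simps)
  then have eq: "inverse (1 + (r / l)\<^sup>2) / l = l / q"
    using pos by (simp add: power2_eq_square)
  have arctan: "((\<lambda>r. arctan (r / l)) has_real_derivative l / q) (at r)"
    unfolding eq[symmetric] using pos by (auto intro!: derivative_eq_intros)
  \<comment> \<open>Both terms become rational over powers of q on differentiation, and they combine
    to 4 m l r^2 / (pi q^2).\<close>
  have "((\<lambda>r. 2 * m / pi * (arctan (r / l) - l * r / (r\<^sup>2 + l\<^sup>2))) has_real_derivative
      2 * m / pi * (l / q - (l * q - l * r * (2 * r)) / (q * q))) (at r)"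
    by (rule derivative_eq_intros arctan refl | use q in \<open>simp flip: q_def\<close>)+
  then show "(dymnikova m l has_real_derivative dymnikova_\<rho> r * r\<^sup>2 / 2) (at r)"
    unfolding dymnikova_def[abs_def]
    by (rule DERIV_cong) (use q in \<open>simp add: dymnikova_\<rho>_def flip: q_def, simp add: field_simps power2_eq_square\<close>)
  have "((\<lambda>r. 8 * m * l / pi / (r\<^sup>2 + l\<^sup>2)\<^sup>2 * r\<^sup>2 / 2) has_real_derivative
      8 * m * l / pi * (2 * r * q\<^sup>2 - r\<^sup>2 * (2 * q * (2 * r))) / (q\<^sup>2 * q\<^sup>2) / 2) (at r)"
    using q by (auto intro!: derivative_eq_intros simp flip: q_def) (simp add: field_simps)
  then show "((\<lambda>r. dymnikova_\<rho> r * r\<^sup>2 / 2) has_real_derivative - r * dymnikova_p r) (at r)"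
    unfolding dymnikova_\<rho>_def[abs_def]
    by (rule DERIV_cong) (use q in \<open>simp add: dymnikova_p_def flip: q_def, simp add: field_simps, simp add: q_def, algebra\<close>)
  show "dymnikova_\<rho> r > 0"
    using q pos by (simp add: dymnikova_\<rho>_def flip: q_def)
next
  show "isCont dymnikova_\<rho> 0" "isCont dymnikova_p 0"
    unfolding dymnikova_\<rho>_def[abs_def] dymnikova_p_def[abs_def] using pos
    by (auto intro!: continuous_intros)
qed (simp add: dymnikova_def)

definition fan_wang_\<rho> where "fan_wang_\<rho> r = 6 * m * l / (r + l) ^ 4"
definition fan_wang_p where "fan_wang_p r = 6 * m * l * (r - l) / (r + l) ^ 5"

lemma regular_fan_wang: "regular_mass_function (fan_wang m l) fan_wang_\<rho> fan_wang_p"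
proof
  fix r :: real
  define q where "q = r + l"
  {
    assume "r \<ge> 0"
    then have q: "q > 0" using pos by (simp add: q_def)
    have "((\<lambda>r. m * r ^ 3 / (r + l) ^ 3) has_real_derivative
       (3 * m * r\<^sup>2 * q ^ 3 - m * r ^ 3 * (3 * q\<^sup>2)) / (q ^ 3 * q ^ 3)) (at r)"
      using q by (auto intro!: derivative_eq_intros simp flip: q_def)
    then show "(fan_wang m l has_real_derivative fan_wang_\<rho> r * r\<^sup>2 / 2) (at r)"
      unfolding fan_wang_def[abs_def]
      by (rule DERIV_cong) (use q in \<open>simp add: fan_wang_\<rho>_def flip: q_def, simp add: field_simps, simp add: q_def, algebra\<close>)
    show "fan_wang_\<rho> r > 0"
      using q pos by (simp add: fan_wang_\<rho>_def flip: q_def)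
  }
  assume "r > 0"
  then have q: "q > 0" using pos by (simp add: q_def)
  have "((\<lambda>r. 6 * m * l / (r + l) ^ 4 * r\<^sup>2 / 2) has_real_derivative
      3 * m * l * (2 * r * q ^ 4 - r\<^sup>2 * (4 * q ^ 3)) / (q ^ 4 * q ^ 4)) (at r)"
    using q by (auto intro!: derivative_eq_intros simp flip: q_def) (simp add: field_simps)
  then show "((\<lambda>r. fan_wang_\<rho> r * r\<^sup>2 / 2) has_real_derivative - r * fan_wang_p r) (at r)"
    unfolding fan_wang_\<rho>_def[abs_def]
    by (rule DERIV_cong) (use q in \<open>simp add: fan_wang_p_def flip: q_def, simp add: field_simps, simp add: q_def, algebra\<close>)
next
  show "isCont fan_wang_\<rho> 0" "isCont fan_wang_p 0"
    unfolding fan_wang_\<rho>_def[abs_def] fan_wang_p_def[abs_def] using pos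
    by (auto intro!: continuous_intros)
qed (simp add: fan_wang_def)

section \<open>Signs of the sum and difference of density and pressure\<close>

text \<open>The factor 4 l^2 - r^2 is the origin of the DEC radius 2 l; the SEC radius comes from
  the factor 3 r^2 - 2 l^2 of \<open>bardeen_p\<close>.\<close>

lemma bardeen_sum_diff:
  "bardeen_\<rho> r + bardeen_p r = 15 * m * l\<^sup>2 * r\<^sup>2 / q r ^ 7"
  "bardeen_\<rho> r - bardeen_p r = 3 * m * l\<^sup>2 * (4 * l\<^sup>2 - r\<^sup>2) / q r ^ 7"
proof -
  have q2: "r\<^sup>2 + l\<^sup>2 = (q r)\<^sup>2" by (simp add: q_def)
  have "bardeen_\<rho> r = 6 * m * l\<^sup>2 * (r\<^sup>2 + l\<^sup>2) / q r ^ 7"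
    unfolding q2 using q_pos[of r] by (simp add: bardeen_\<rho>_def power_eq_if)
  then show "bardeen_\<rho> r + bardeen_p r = 15 * m * l\<^sup>2 * r\<^sup>2 / q r ^ 7"
    "bardeen_\<rho> r - bardeen_p r = 3 * m * l\<^sup>2 * (4 * l\<^sup>2 - r\<^sup>2) / q r ^ 7"
    by (simp_all add: bardeen_p_def field_simps flip: add_divide_distrib diff_divide_distrib)
qed

lemma hayward_sum_diff:
  assumes "r \<ge> 0"
  shows "hayward_\<rho> r + hayward_p r = 36 * m\<^sup>2 * l\<^sup>2 * r ^ 3 / (r ^ 3 + 2 * m * l\<^sup>2) ^ 3"
    "hayward_\<rho> r - hayward_p r = 12 * m\<^sup>2 * l\<^sup>2 * (4 * m * l\<^sup>2 - r ^ 3) / (r ^ 3 + 2 * m * l\<^sup>2) ^ 3"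
proof -
  have "hayward_\<rho> r = 12 * m\<^sup>2 * l\<^sup>2 * (r ^ 3 + 2 * m * l\<^sup>2) / (r ^ 3 + 2 * m * l\<^sup>2) ^ 3"
    using hayward_denominator_pos[OF assms] by (simp add: hayward_\<rho>_def power2_eq_square power3_eq_cube)
  then show "hayward_\<rho> r + hayward_p r = 36 * m\<^sup>2 * l\<^sup>2 * r ^ 3 / (r ^ 3 + 2 * m * l\<^sup>2) ^ 3"
    "hayward_\<rho> r - hayward_p r = 12 * m\<^sup>2 * l\<^sup>2 * (4 * m * l\<^sup>2 - r ^ 3) / (r ^ 3 + 2 * m * l\<^sup>2) ^ 3"
    by (simp_all add: hayward_p_def algebra_simps flip: add_divide_distrib diff_divide_distrib)
qed

text \<open>The numerator of the difference is positive and independent of r, which is why the DEC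
  never fails here. The Fan-Wang difference behaves in the same way for r \<ge> 0.\<close>

lemma dymnikova_sum_diff:
  "dymnikova_\<rho> r + dymnikova_p r = 16 * m * l / pi * r\<^sup>2 / (r\<^sup>2 + l\<^sup>2) ^ 3"
  "dymnikova_\<rho> r - dymnikova_p r = 16 * m * l / pi * l\<^sup>2 / (r\<^sup>2 + l\<^sup>2) ^ 3"
proof -
  have "r\<^sup>2 + l\<^sup>2 > 0" using pos by (simp add: add_nonneg_pos)
  then have "dymnikova_\<rho> r = 8 * m * l / pi * (r\<^sup>2 + l\<^sup>2) / (r\<^sup>2 + l\<^sup>2) ^ 3"
    by (simp add: dymnikova_\<rho>_def power2_eq_square power3_eq_cube)
  then show "dymnikova_\<rho> r + dymnikova_p r = 16 * m * l / pi * r\<^sup>2 / (r\<^sup>2 + l\<^sup>2) ^ 3"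
    "dymnikova_\<rho> r - dymnikova_p r = 16 * m * l / pi * l\<^sup>2 / (r\<^sup>2 + l\<^sup>2) ^ 3"
    by (simp_all add: dymnikova_p_def algebra_simps flip: add_divide_distrib diff_divide_distrib)
qed

lemma fan_wang_sum_diff:
  assumes "r \<ge> 0"
  shows "fan_wang_\<rho> r + fan_wang_p r = 12 * m * l * r / (r + l) ^ 5"
    "fan_wang_\<rho> r - fan_wang_p r = 12 * m * l * l / (r + l) ^ 5"
proof -
  have "fan_wang_\<rho> r = 6 * m * l * (r + l) / (r + l) ^ 5"
    using assms pos by (simp add: fan_wang_\<rho>_def power_eq_if)
  then show "fan_wang_\<rho> r + fan_wang_p r = 12 * m * l * r / (r + l) ^ 5"
    "fan_wang_\<rho> r - fan_wang_p r = 12 * m * l * l / (r + l) ^ 5"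
    by (simp_all add: fan_wang_p_def algebra_simps flip: add_divide_distrib diff_divide_distrib)
qed

lemma bardeen_conditions:
  "holds_everywhere (bardeen m l) NEC" "holds_everywhere (bardeen m l) WEC"
  "holds_exactly (bardeen m l) DEC {0..2 * l}"
  "holds_exactly (bardeen m l) SEC {sqrt (2 / 3) * l..}"
proof -
  interpret regular_mass_function "bardeen m l" bardeen_\<rho> bardeen_p by (rule regular_bardeen)
  have nec: "bardeen_\<rho> r + bardeen_p r \<ge> 0" for r
    using pos q_pos[of r] by (simp add: bardeen_sum_diff)
  show "holds_everywhere (bardeen m l) NEC" "holds_everywhere (bardeen m l) WEC"
    by (rule holds_everywhere_NEC_WEC, rule nec)+
  show "holds_exactly (bardeen m l) DEC {0..2 * l}"
  proof (rule holds_exactly_DEC_SEC[OF nec])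
    fix r :: real assume "r \<ge> 0"
    have "bardeen_\<rho> r - bardeen_p r \<ge> 0 \<longleftrightarrow> r\<^sup>2 \<le> (2 * l)\<^sup>2"
      unfolding bardeen_sum_diff
      by (subst scaled_nonneg_iff) (use pos q_pos[of r] in \<open>simp_all add: power_mult_distrib\<close>)
    also have "\<dots> \<longleftrightarrow> r \<in> {0..2 * l}"
      using power_mono_iff[of r "2 * l" 2] pos \<open>r \<ge> 0\<close> by auto
    finally show "bardeen_\<rho> r - bardeen_p r \<ge> 0 \<longleftrightarrow> r \<in> {0..2 * l}" .
  qed
  show "holds_exactly (bardeen m l) SEC {sqrt (2 / 3) * l..}"
  proof (rule holds_exactly_DEC_SEC[OF nec])
    fix r :: real assume "r \<ge> 0"
    have "bardeen_p r \<ge> 0 \<longleftrightarrow> (sqrt (2 / 3) * l)\<^sup>2 \<le> r\<^sup>2"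
      unfolding bardeen_p_def
      by (subst scaled_nonneg_iff) (use pos q_pos[of r] in \<open>auto simp: power_mult_distrib\<close>)
    also have "\<dots> \<longleftrightarrow> r \<in> {sqrt (2 / 3) * l..}"
      using pos \<open>r \<ge> 0\<close> by (simp add: power_mono_iff)
    finally show "bardeen_p r \<ge> 0 \<longleftrightarrow> r \<in> {sqrt (2 / 3) * l..}" .
  qed
qed

lemma hayward_conditions:
  "holds_everywhere (hayward m l) NEC" "holds_everywhere (hayward m l) WEC"
  "holds_exactly (hayward m l) DEC {0..root 3 (4 * m * l^2)}"
  "holds_exactly (hayward m l) SEC {root 3 (m * l^2)..}"
proof -
  interpret regular_mass_function "hayward m l" hayward_\<rho> hayward_p by (rule regular_hayward)
  have nec: "hayward_\<rho> r + hayward_p r \<ge> 0" if "r \<ge> 0" for r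
    using pos that by (simp add: hayward_sum_diff)
  show "holds_everywhere (hayward m l) NEC" "holds_everywhere (hayward m l) WEC"
    by (rule holds_everywhere_NEC_WEC, erule nec)+
  have root: "root 3 (r ^ 3) = r" if "r \<ge> 0" for r :: real
    using that by (simp add: real_root_power_cancel)
  show "holds_exactly (hayward m l) DEC {0..root 3 (4 * m * l^2)}"
  proof (rule holds_exactly_DEC_SEC[OF nec])
    fix r :: real assume r: "r \<ge> 0"
    have "hayward_\<rho> r - hayward_p r \<ge> 0 \<longleftrightarrow> r ^ 3 \<le> 4 * m * l\<^sup>2"
      unfolding hayward_sum_diff[OF r]
      by (subst scaled_nonneg_iff) (use pos hayward_denominator_pos[OF r] in simp_all)
    also have "\<dots> \<longleftrightarrow> root 3 (r ^ 3) \<le> root 3 (4 * m * l\<^sup>2)"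
      by (rule real_root_le_iff[symmetric]) simp
    also have "\<dots> \<longleftrightarrow> r \<in> {0..root 3 (4 * m * l\<^sup>2)}"
      using r by (simp add: root)
    finally show "hayward_\<rho> r - hayward_p r \<ge> 0 \<longleftrightarrow> r \<in> {0..root 3 (4 * m * l\<^sup>2)}" .
  qed
  show "holds_exactly (hayward m l) SEC {root 3 (m * l^2)..}"
  proof (rule holds_exactly_DEC_SEC[OF nec])
    fix r :: real assume r: "r \<ge> 0"
    have "hayward_p r \<ge> 0 \<longleftrightarrow> m * l\<^sup>2 \<le> r ^ 3"
      unfolding hayward_p_def
      by (subst scaled_nonneg_iff) (use pos hayward_denominator_pos[OF r] in simp_all)
    also have "\<dots> \<longleftrightarrow> root 3 (m * l\<^sup>2) \<le> root 3 (r ^ 3)"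
      by (rule real_root_le_iff[symmetric]) simp
    also have "\<dots> \<longleftrightarrow> r \<in> {root 3 (m * l\<^sup>2)..}"
      using r by (simp add: root)
    finally show "hayward_p r \<ge> 0 \<longleftrightarrow> r \<in> {root 3 (m * l\<^sup>2)..}" .
  qed
qed

lemma dymnikova_conditions:
  "holds_everywhere (dymnikova m l) NEC" "holds_everywhere (dymnikova m l) WEC"
  "holds_everywhere (dymnikova m l) DEC"
  "holds_exactly (dymnikova m l) SEC {l..}"
proof -
  interpret regular_mass_function "dymnikova m l" dymnikova_\<rho> dymnikova_p
    by (rule regular_dymnikova)
  have nec: "dymnikova_\<rho> r + dymnikova_p r \<ge> 0" for r
    using pos by (simp add: dymnikova_sum_diff)
  show "holds_everywhere (dymnikova m l) NEC" "holds_everywhere (dymnikova m l) WEC"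
    by (rule holds_everywhere_NEC_WEC, rule nec)+
  show "holds_everywhere (dymnikova m l) DEC"
    unfolding holds_everywhere_iff_exactly
    by (rule holds_exactly_DEC_SEC[OF nec]) (use pos in \<open>simp add: dymnikova_sum_diff\<close>)
  show "holds_exactly (dymnikova m l) SEC {l..}"
  proof (rule holds_exactly_DEC_SEC[OF nec])
    fix r :: real assume "r \<ge> 0"
    have "r\<^sup>2 + l\<^sup>2 > 0" using pos by (simp add: add_nonneg_pos)
    then have "dymnikova_p r \<ge> 0 \<longleftrightarrow> l\<^sup>2 \<le> r\<^sup>2"
      unfolding dymnikova_p_def by (subst scaled_nonneg_iff) (use pos in simp_all)
    also have "\<dots> \<longleftrightarrow> r \<in> {l..}"
      using pos \<open>r \<ge> 0\<close> by (simp add: power_mono_iff)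
    finally show "dymnikova_p r \<ge> 0 \<longleftrightarrow> r \<in> {l..}" .
  qed
qed

lemma fan_wang_conditions:
  "holds_everywhere (fan_wang m l) NEC" "holds_everywhere (fan_wang m l) WEC"
  "holds_everywhere (fan_wang m l) DEC"
  "holds_exactly (fan_wang m l) SEC {l..}"
proof -
  interpret regular_mass_function "fan_wang m l" fan_wang_\<rho> fan_wang_p
    by (rule regular_fan_wang)
  have nec: "fan_wang_\<rho> r + fan_wang_p r \<ge> 0" if "r \<ge> 0" for r
    using pos that by (simp add: fan_wang_sum_diff)
  show "holds_everywhere (fan_wang m l) NEC" "holds_everywhere (fan_wang m l) WEC"
    by (rule holds_everywhere_NEC_WEC, erule nec)+
  show "holds_everywhere (fan_wang m l) DEC"
    unfolding holds_everywhere_iff_exactly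
    by (rule holds_exactly_DEC_SEC[OF nec]) (use pos in \<open>simp_all add: fan_wang_sum_diff\<close>)
  show "holds_exactly (fan_wang m l) SEC {l..}"
    by (rule holds_exactly_DEC_SEC[OF nec], assumption)
      (unfold fan_wang_p_def, subst scaled_nonneg_iff, use pos in simp_all)
qed

end

theorem mainTheorem1:
  fixes l m :: real
  assumes "l > 0" and "m > 0"
  shows
    "(\<forall>M \<in> {bardeen m l, hayward m l, dymnikova m l, fan_wang m l}.
        holds_everywhere M NEC \<and> holds_everywhere M WEC) \<and>
     holds_exactly (bardeen m l) DEC {0..2 * l} \<and>
     holds_exactly (bardeen m l) SEC {sqrt (2 / 3) * l..} \<and>
     holds_exactly (hayward m l) DEC {0..root 3 (4 * m * l^2)} \<and>
     holds_exactly (hayward m l) SEC {root 3 (m * l^2)..} \<and>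
     holds_everywhere (dymnikova m l) DEC \<and>
     holds_exactly (dymnikova m l) SEC {l..} \<and>
     holds_everywhere (fan_wang m l) DEC \<and>
     holds_exactly (fan_wang m l) SEC {l..} \<and>
     violated_asymptotically (bardeen m l) DEC \<and>
     violated_asymptotically (hayward m l) DEC \<and>
     (\<forall>M \<in> {dymnikova m l, fan_wang m l}. \<forall>C \<in> {NEC, WEC, DEC, SEC}. holds_asymptotically M C)"
proof -
  note conditions = bardeen_conditions[OF assms] hayward_conditions[OF assms]
    dymnikova_conditions[OF assms] fan_wang_conditions[OF assms]
  have "holds_asymptotically M C" if "holds_everywhere M C" for M C
    using that unfolding holds_everywhere_iff_exactly by (rule holds_exactly_imp_asymptotically)
  then show ?thesis
    using conditions holds_exactly_imp_asymptotically holds_exactly_imp_violated_asymptotically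
    by auto
qed

end
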